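(* Let $\omega>0$ and suppose $(h,c)$, with $h\colon\mathcal{X}\to\mathcal{Y}$ and $c\colon\mathcal{X}\to[0,1]$, is an optimal solution to the bounded-coverage problem $$\min_{h,c}\ R_S(h,c)\quad\text{s.t.}\quad\phi(c)\ge\omega .$$ Let $h_B\colon\mathcal{X}\to\mathcal{Y}$ be a Bayes classifier, i.e. $h_B(x)\in\operatorname{argmin}_{\hat y\in\mathcal{Y}}\sum_{y\in\mathcal{Y}}p(y\mid x)\,\ell(y,\hat y)$ for every $x\in\mathcal{X}$. Then $(h_B,c)$ is also an optimal solution to this problem.
   Context: $\mathcal{X}$ is a set of inputs (a measurable space with a fixed reference measure $dx$), $\mathcal{Y}$ is a finite set of labels, $p(x,y)$ is a probability density on $\mathcal{X}\times\mathcal{Y}$ (with respect to $dx$ times counting measure), $p(x)=\sum_{y\in\mathcal{Y}}p(x,y)$ is its marginal, and $p(y\mid x)$ is the conditional distribution, so $p(x,y)=p(x)p(y\mid x)$. $\ell\colon\mathcal{Y}\times\mathcal{Y}\to[0,\infty)$ is a loss. A classifier is a function $h\colon\mathcal{X}\to\mathcal{Y}$, a selection function is a function $c\colon\mathcal{X}\to[0,1]$; all functions are taken measurable. The coverage of $c$ is $\phi(c)=\int_{\mathcal{X}}p(x)c(x)\,dx$, and the selective risk of $(h,c)$ is $$R_S(h,c)=\frac{\int_{\mathcal{X}}\sum_{y\in\mathcal{Y}}p(x,y)\,\ell(y,h(x))\,c(x)\,dx}{\phi(c)},$$ defined when $\phi(c)\neq 0$. It is assumed that minimizers of the problem exist.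 *)

theory Defs
  imports "HOL-Analysis.Analysis"
begin

definition marginal :: "('x \<Rightarrow> 'y::finite \<Rightarrow> real) \<Rightarrow> 'x \<Rightarrow> real" where
  "marginal p x = (\<Sum>y\<in>UNIV. p x y)"

text \<open>
  A density with respect to the product of \<open>M\<close> with counting measure on the finite type of
  labels. The integral over the product is written as the integral over \<open>M\<close> of the finite
  sum over labels, so that \<open>M\<close> need not be sigma-finite.
\<close>

definition joint_density :: "'x measure \<Rightarrow> ('x \<Rightarrow> 'y::finite \<Rightarrow> real) \<Rightarrow> bool" where
  "joint_density M p \<longleftrightarrow>
     case_prod p \<in> borel_measurable (M \<Otimes>\<^sub>M count_space UNIV) \<and>
     (\<forall>x\<in>space M. \<forall>y. 0 \<le> p x y) \<and>
     has_bochner_integral M (marginal p) 1"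

text \<open>
  \<open>q x y\<close> stands for the conditional probability of \<open>y\<close> given \<open>x\<close>. It is determined by
  \<open>p\<close> only where the marginal is positive. Where the marginal vanishes any version is
  admitted, including both an arbitrary probability vector and the convention \<open>0 / 0 = 0\<close>.
\<close>

definition conditional_distribution ::
  "'x measure \<Rightarrow> ('x \<Rightarrow> 'y::finite \<Rightarrow> real) \<Rightarrow> ('x \<Rightarrow> 'y \<Rightarrow> real) \<Rightarrow> bool" where
  "conditional_distribution M p q \<longleftrightarrow>
     case_prod q \<in> borel_measurable (M \<Otimes>\<^sub>M count_space UNIV) \<and>
     (\<forall>x\<in>space M. marginal p x > 0 \<longrightarrow> (\<forall>y. 0 \<le> q x y) \<and> (\<Sum>y\<in>UNIV. q x y) = 1) \<and>
     (\<forall>x\<in>space M. \<forall>y. p x y = marginal p x * q x y)"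

definition classifier :: "'x measure \<Rightarrow> ('x \<Rightarrow> 'y) \<Rightarrow> bool" where
  "classifier M h \<longleftrightarrow> h \<in> measurable M (count_space UNIV)"

definition selection :: "'x measure \<Rightarrow> ('x \<Rightarrow> real) \<Rightarrow> bool" where
  "selection M c \<longleftrightarrow> c \<in> borel_measurable M \<and> (\<forall>x\<in>space M. c x \<in> {0..1})"

definition coverage ::
  "'x measure \<Rightarrow> ('x \<Rightarrow> 'y::finite \<Rightarrow> real) \<Rightarrow> ('x \<Rightarrow> real) \<Rightarrow> real" where
  "coverage M p c = (\<integral>x. marginal p x * c x \<partial>M)"

definition selective_risk ::
  "'x measure \<Rightarrow> ('x \<Rightarrow> 'y::finite \<Rightarrow> real) \<Rightarrow> ('y \<Rightarrow> 'y \<Rightarrow> real) \<Rightarrow>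
   ('x \<Rightarrow> 'y) \<Rightarrow> ('x \<Rightarrow> real) \<Rightarrow> real" where
  "selective_risk M p l h c =
     (\<integral>x. (\<Sum>y\<in>UNIV. p x y * l y (h x) * c x) \<partial>M) / coverage M p c"

definition bounded_coverage_optimal ::
  "'x measure \<Rightarrow> ('x \<Rightarrow> 'y::finite \<Rightarrow> real) \<Rightarrow> ('y \<Rightarrow> 'y \<Rightarrow> real) \<Rightarrow> real \<Rightarrow>
   ('x \<Rightarrow> 'y) \<Rightarrow> ('x \<Rightarrow> real) \<Rightarrow> bool" where
  "bounded_coverage_optimal M p l \<omega> h c \<longleftrightarrow>
     is_arg_min (\<lambda>(h, c). selective_risk M p l h c)
       (\<lambda>(h, c). classifier M h \<and> selection M c \<and> coverage M p c \<ge> \<omega>) (h, c)"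

definition bayes_classifier ::
  "'x measure \<Rightarrow> ('x \<Rightarrow> 'y::finite \<Rightarrow> real) \<Rightarrow> ('y \<Rightarrow> 'y \<Rightarrow> real) \<Rightarrow> ('x \<Rightarrow> 'y) \<Rightarrow> bool" where
  "bayes_classifier M q l h \<longleftrightarrow>
     classifier M h \<and>
     (\<forall>x\<in>space M. is_arg_min (\<lambda>y'. \<Sum>y\<in>UNIV. q x y * l y y') (\<lambda>_. True) (h x))"

end

theory Submission
  imports Defs
begin

text \<open>
  Pointwise the conditional risk of a Bayes classifier is minimal; multiplying by
  \<open>p(x) c(x) \<ge> 0\<close> and integrating keeps the inequality, and the coverage does not depend on
  the classifier. The integral of the larger side must be known to exist, since the Bochner
  integral of a non-integrable function is \<open>0\<close>; it does because the loss takes finitely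
  many values.
\<close>

lemma selective_loss_bounds:
  fixes p :: "'x \<Rightarrow> 'y::finite \<Rightarrow> real"
    and l :: "'y \<Rightarrow> 'y \<Rightarrow> real"
  assumes p: "joint_density M p" and x: "x \<in> space M"
    and l: "\<And>y y'. 0 \<le> l y y'" and c: "selection M c"
  shows "0 \<le> (\<Sum>y\<in>UNIV. p x y * l y z * c x)"
    and "(\<Sum>y\<in>UNIV. p x y * l y z * c x) \<le> (\<Sum>y\<in>UNIV. \<Sum>y'\<in>UNIV. l y y') * marginal p x"
proof -
  have p0: "0 \<le> p x y" for y
    using p x by (auto simp: joint_density_def)
  have c01: "0 \<le> c x" "c x \<le> 1"
    using c x by (auto simp: selection_def)
  show "0 \<le> (\<Sum>y\<in>UNIV. p x y * l y z * c x)"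
    using p0 l c01 by (intro sum_nonneg mult_nonneg_nonneg) auto
  \<comment> \<open>Since losses are nonnegative, the sum of all of them dominates each one. This
    constant does not depend on \<open>z\<close>, so it still serves when \<open>z\<close> is
    \<open>h x\<close> and varies with \<open>x\<close>.\<close>
  have bound: "l y z \<le> (\<Sum>y\<in>UNIV. \<Sum>y'\<in>UNIV. l y y')" for y
  proof -
    have "l y z \<le> (\<Sum>y'\<in>UNIV. l y y')"
      using l by (intro member_le_sum) auto
    also have "\<dots> \<le> (\<Sum>y\<in>UNIV. \<Sum>y'\<in>UNIV. l y y')"
      using l by (intro member_le_sum[of y UNIV "\<lambda>y. \<Sum>y'\<in>UNIV. l y y'"] sum_nonneg) auto
    finally show ?thesis .
  qed
  have "(\<Sum>y\<in>UNIV. p x y * l y z * c x) \<le> (\<Sum>y\<in>UNIV. p x y * (\<Sum>y\<in>UNIV. \<Sum>y'\<in>UNIV. l y y'))"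
  proof (rule sum_mono)
    fix y
    have "p x y * l y z * c x \<le> p x y * l y z"
      using p0 l c01 by (intro mult_left_le mult_nonneg_nonneg) auto
    also have "\<dots> \<le> p x y * (\<Sum>y\<in>UNIV. \<Sum>y'\<in>UNIV. l y y')"
      by (intro mult_left_mono bound p0)
    finally show "p x y * l y z * c x \<le> p x y * (\<Sum>y\<in>UNIV. \<Sum>y'\<in>UNIV. l y y')" .
  qed
  then show "(\<Sum>y\<in>UNIV. p x y * l y z * c x) \<le> (\<Sum>y\<in>UNIV. \<Sum>y'\<in>UNIV. l y y') * marginal p x"
    by (simp add: marginal_def sum_distrib_right[symmetric] mult.commute)
qed

text \<open>A constant multiple of \<open>marginal p\<close>, whose integral is 1, dominates the
  integrand.\<close>

lemma integrable_selective_loss: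
  fixes p :: "'x \<Rightarrow> 'y::finite \<Rightarrow> real"
    and l :: "'y \<Rightarrow> 'y \<Rightarrow> real"
  assumes p: "joint_density M p" and l: "\<And>y y'. 0 \<le> l y y'"
    and h: "classifier M h" and c: "selection M c"
  shows "integrable M (\<lambda>x. \<Sum>y\<in>UNIV. p x y * l y (h x) * c x)"
proof (rule Bochner_Integration.integrable_bound)
  show "integrable M (\<lambda>x. (\<Sum>y\<in>UNIV. \<Sum>y'\<in>UNIV. l y y') * marginal p x)"
    using p by (auto simp: joint_density_def has_bochner_integral_iff)
  have [measurable]: "(\<lambda>x. p x y) \<in> borel_measurable M" for y
    using p measurable_compose[OF measurable_Pair2', of y "count_space UNIV" "case_prod p" M borel]
    by (auto simp: joint_density_def)
  have [measurable]: "(\<lambda>x. l y (h x)) \<in> borel_measurable M" for y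
    using h measurable_compose[of h M "count_space UNIV" "l y" borel]
    by (auto simp: classifier_def)
  have [measurable]: "c \<in> borel_measurable M"
    using c by (simp add: selection_def)
  show "(\<lambda>x. \<Sum>y\<in>UNIV. p x y * l y (h x) * c x) \<in> borel_measurable M"
    by measurable
  show "AE x in M. norm (\<Sum>y\<in>UNIV. p x y * l y (h x) * c x)
      \<le> norm ((\<Sum>y\<in>UNIV. \<Sum>y'\<in>UNIV. l y y') * marginal p x)"
  proof (rule AE_I2)
    fix x assume "x \<in> space M"
    from selective_loss_bounds[where l = l and z = "h x", OF p this l c]
    show "norm (\<Sum>y\<in>UNIV. p x y * l y (h x) * c x)
        \<le> norm ((\<Sum>y\<in>UNIV. \<Sum>y'\<in>UNIV. l y y') * marginal p x)"
      unfolding real_norm_def by linarith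
  qed
qed

lemma bayes_classifier_selective_risk_le:
  fixes p q :: "'x \<Rightarrow> 'y::finite \<Rightarrow> real"
    and l :: "'y \<Rightarrow> 'y \<Rightarrow> real"
  assumes p: "joint_density M p" and q: "conditional_distribution M p q"
    and l: "\<And>y y'. 0 \<le> l y y'"
    and h: "classifier M h" and c: "selection M c" and "0 \<le> coverage M p c"
    and b: "bayes_classifier M q l h\<^sub>B"
  shows "selective_risk M p l h\<^sub>B c \<le> selective_risk M p l h c"
  unfolding selective_risk_def
\<comment> \<open>The denominators agree; were they 0, both quotients would be 0.
  \<open>integral_mono'\<close> asks that the larger integrand be integrable and nonnegative: a
  non-integrable smaller one would have integral 0, which is then still a lower bound.\<close>
proof (intro divide_right_mono integral_mono' integrable_selective_loss p l h c)
  fix x assume x: "x \<in> space M"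
  show "0 \<le> (\<Sum>y\<in>UNIV. p x y * l y (h x) * c x)"
    by (rule selective_loss_bounds(1)[where l = l, OF p x l c])
  \<comment> \<open>The factorization of \<open>p\<close> holds at every point of
    \<open>space M\<close>, so no case split on a vanishing marginal arises. Keeping
    \<open>z\<close> free lets one identity rewrite both sides of the comparison.\<close>
  have risk: "(\<Sum>y\<in>UNIV. p x y * l y z * c x) = marginal p x * c x * (\<Sum>y\<in>UNIV. q x y * l y z)" for z
    using q x by (simp add: conditional_distribution_def sum_distrib_left mult_ac)
  have "0 \<le> marginal p x"
    using p x by (auto simp: marginal_def joint_density_def intro!: sum_nonneg)
  moreover have "0 \<le> c x"
    using c x by (auto simp: selection_def)
  moreover have "(\<Sum>y\<in>UNIV. q x y * l y (h\<^sub>B x)) \<le> (\<Sum>y\<in>UNIV. q x y * l y (h x))"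
    using b x by (auto simp: bayes_classifier_def is_arg_min_def not_less)
  ultimately show "(\<Sum>y\<in>UNIV. p x y * l y (h\<^sub>B x) * c x) \<le> (\<Sum>y\<in>UNIV. p x y * l y (h x) * c x)"
    unfolding risk by (intro mult_left_mono mult_nonneg_nonneg)
qed fact

theorem theorem4:
  fixes M :: "'x measure"
    and p q :: "'x \<Rightarrow> 'y::finite \<Rightarrow> real"
    and l :: "'y \<Rightarrow> 'y \<Rightarrow> real"
    and \<omega> :: real
    and h h\<^sub>B :: "'x \<Rightarrow> 'y"
    and c :: "'x \<Rightarrow> real"
  assumes "joint_density M p"
    and "conditional_distribution M p q"
    and "\<And>y y'. 0 \<le> l y y'"
    and "\<omega> > 0"
    and "bounded_coverage_optimal M p l \<omega> h c"
    and "bayes_classifier M q l h\<^sub>B"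
  shows "bounded_coverage_optimal M p l \<omega> h\<^sub>B c"
proof -
  have h: "classifier M h" and c: "selection M c" and cov: "\<omega> \<le> coverage M p c"
    using assms(5) by (auto simp: bounded_coverage_optimal_def is_arg_min_def)
  have "selective_risk M p l h\<^sub>B c \<le> selective_risk M p l h c"
    using assms cov by (intro bayes_classifier_selective_risk_le[OF _ _ _ h c]) auto
  moreover have "classifier M h\<^sub>B"
    using assms(6) by (simp add: bayes_classifier_def)
  \<comment> \<open>The coverage constraint involves \<open>c\<close> alone, so the new pair is
    feasible. A feasible pair of strictly smaller risk would also beat \<open>(h, c)\<close>,
    against its optimality.\<close>
  ultimately show ?thesis
    using assms(5) by (fastforce simp: bounded_coverage_optimal_def is_arg_min_def)
qed

end
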